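(* The map $\Phi\colon (\mathcal{P}\times\mathcal{P})^+/\mathrm{SL}_2(\mathbb{Z})\longrightarrow \mathbf{SL}_2^+$, which sends the $\mathrm{SL}_2(\mathbb{Z})$-orbit of a pair $(\gamma,\delta)\in(\mathcal{P}\times\mathcal{P})^+$ to $\widetilde{\Phi}(\gamma,\delta)=\pm\mathbf{M}$, is a one-to-one correspondence (a bijection).
   Context: An $\mathrm{SL}_2$-tiling is a function $\mathbf{M}\colon\mathbb{Z}\times\mathbb{Z}\to\mathbb{Z}$, with $m_{i,j}=\mathbf{M}(i,j)$, such that $m_{i,j}m_{i+1,j+1}-m_{i,j+1}m_{i+1,j}=1$ for all $i,j\in\mathbb{Z}$. It is tame if every $3\times 3$ submatrix of consecutive rows and columns has determinant $0$. $\mathbf{SL}_2$ is the set of tame $\mathrm{SL}_2$-tilings modulo identifying $\mathbf{M}$ and $-\mathbf{M}$. $\mathbf{SL}_2^+$ is the set of $\mathrm{SL}_2$-tilings all of whose entries are positive integers (all such tilings are tame), regarded as a subset of $\mathbf{SL}_2$ via $\mathbf{M}\mapsto\pm\mathbf{M}$. A reduced rational is an expression $a/b$ with $a,b$ coprime integers, where $1/0$ and $(-1)/0$ are allowed and both represent $\infty$. The Farey graph $\mathcal{F}$ has vertex set $\mathbb{Q}_\infty=\mathbb{Q}\cup\{\infty\}$, with reduced rationals $a/b$ and $c/d$ adjacent if and only if $ad-bc=\pm1$. A bi-infinite path in $\mathcal{F}$ is a sequence $\langle\dots,v_{-1},v_0,v_1,v_2,\dots\rangle$ of vertices indexed by $\mathbb{Z}$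 with $v_i$ adjacent to $v_{i+1}$ for all $i$; $\mathcal{P}$ is the set of all of them. $\mathrm{SL}_2(\mathbb{Z})$ acts on $\mathbb{Q}_\infty$ by Möbius transformations $z\mapsto\frac{az+b}{cz+d}$, preserving adjacency, hence acts on $\mathcal{P}$ vertexwise and on $\mathcal{P}\times\mathcal{P}$ diagonally. Given $(\gamma,\delta)\in\mathcal{P}\times\mathcal{P}$, write the vertices of $\gamma$ as reduced rationals $a_i/b_i$ with $a_ib_{i+1}-a_{i+1}b_i=1$ and the vertices of $\delta$ as reduced rationals $c_j/d_j$ with $c_jd_{j+1}-c_{j+1}d_j=1$ ($i,j\in\mathbb{Z}$); each of these is possible in exactly two ways, differing by a global sign. Put $m_{i,j}=a_id_j-b_ic_j$. Then $\mathbf{M}$ is a tame $\mathrm{SL}_2$-tiling and $\widetilde{\Phi}(\gamma,\delta)=\pm\mathbf{M}\in\mathbf{SL}_2$ is well defined and depends only on the $\mathrm{SL}_2(\mathbb{Z})$-orbit of $(\gamma,\delta)$. Identify $\mathbb{R}_\infty=\mathbb{R}\cup\{\infty\}$ with the unit circle by $z\mapsto(iz+1)/(z+i)$ (so $\infty\mapsto i$, $1\mapsto1$, $0\mapsto-i$, $-1\mapsto-1$; decreasing along $\mathbb{R}$ is clockwise). A sequence of distinct points $(v_i)$ (finite or infinite) of $\mathbb{R}_\infty$ is in clockwise order if, for all indices $i<j<k$, the images of $v_i,v_j,v_k$ are in clockwise order around the unit circle. A bi-infinite path is clockwise if its vertices (indexed by $\mathbb{Z}$) are distinct and in clockwise order.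 Each clockwise bi-infinite path $\gamma$ converges in $\mathbb{R}_\infty$ in the backward direction to a point $\gamma_{-\infty}$ and in the forward direction to a point $\gamma_\infty$. $(\mathcal{P}\times\mathcal{P})^+$ is the set of pairs $(\gamma,\delta)$ of clockwise bi-infinite paths such that $\gamma_{-\infty},\gamma_\infty,\delta_{-\infty},\delta_\infty$ are in clockwise order, where the equalities $\gamma_\infty=\delta_{-\infty}$ and $\gamma_{-\infty}=\delta_\infty$ (either or both) are permitted, but no other coincidences are; in particular $\gamma_\infty\neq\gamma_{-\infty}$ and $\delta_\infty\neq\delta_{-\infty}$. (If exactly one of the permitted equalities holds, the three distinct limit points, listed in this order, are in clockwise order; if both hold, the only requirement is that $\gamma_{-\infty}\ne\gamma_\infty$.) This set is invariant under $\mathrm{SL}_2(\mathbb{Z})$. *)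

theory Defs
  imports "HOL-Analysis.Analysis"
begin

section \<open>\<open>SL\<^sub>2\<close>-tilings\<close>

type_synonym tiling = "int \<Rightarrow> int \<Rightarrow> int"

definition sl2_tiling :: "tiling \<Rightarrow> bool" where
  "sl2_tiling M \<longleftrightarrow> (\<forall>i j. M i j * M (i+1) (j+1) - M i (j+1) * M (i+1) j = 1)"

definition tame :: "tiling \<Rightarrow> bool" where
  "tame M \<longleftrightarrow> (\<forall>i j.
     det (vector [vector [M i j, M i (j+1), M i (j+2)],
                  vector [M (i+1) j, M (i+1) (j+1), M (i+1) (j+2)],
                  vector [M (i+2) j, M (i+2) (j+1), M (i+2) (j+2)]] :: int^3^3) = 0)"

definition sign_rel :: "tiling rel" where
  "sign_rel = {(M, N). N = M \<or> N = (\<lambda>i j. - M i j)}"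

definition SL2_tame :: "tiling set set" where
  "SL2_tame = {M. sl2_tiling M \<and> tame M} // sign_rel"

definition SL2_plus :: "tiling set set" where
  "SL2_plus = {M. sl2_tiling M \<and> (\<forall>i j. M i j > 0)} // sign_rel"


section \<open>The Farey graph, bi-infinite paths and the action of \<open>SL\<^sub>2(\<int>)\<close>\<close>

text \<open>\<open>rat pinf\<close> is \<open>\<rat> \<union> {\<infinity>}\<close> and \<open>real pinf\<close> is \<open>\<real> \<union> {\<infinity>}\<close>.\<close>

datatype 'a pinf = Fin 'a | Infty

definition reduced_rational :: "int \<Rightarrow> int \<Rightarrow> rat pinf \<Rightarrow> bool" where
  "reduced_rational a b v \<longleftrightarrow> coprime a b \<and> v = (if b = 0 then Infty else Fin (of_int a / of_int b))"

definition farey_adj :: "rat pinf \<Rightarrow> rat pinf \<Rightarrow> bool" where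
  "farey_adj u v \<longleftrightarrow> (\<exists>a b c d. reduced_rational a b u \<and> reduced_rational c d v \<and>
     (a * d - b * c = 1 \<or> a * d - b * c = -1))"

type_synonym bipath = "int \<Rightarrow> rat pinf"

definition paths :: "bipath set" where
  "paths = {\<gamma>. \<forall>i. farey_adj (\<gamma> i) (\<gamma> (i+1))}"

definition SL2Z :: "(int^2^2) set" where
  "SL2Z = {A. det A = 1}"

fun moebius :: "int^2^2 \<Rightarrow> rat pinf \<Rightarrow> rat pinf" where
  "moebius A (Fin z) =
     (if of_int (A$2$1) * z + of_int (A$2$2) = 0 then Infty
      else Fin ((of_int (A$1$1) * z + of_int (A$1$2)) / (of_int (A$2$1) * z + of_int (A$2$2))))"
| "moebius A Infty = (if A$2$1 = 0 then Infty else Fin (of_int (A$1$1) / of_int (A$2$1)))"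

definition act :: "int^2^2 \<Rightarrow> bipath \<times> bipath \<Rightarrow> bipath \<times> bipath" where
  "act A p = (moebius A \<circ> fst p, moebius A \<circ> snd p)"

definition orbit_rel :: "(bipath \<times> bipath) rel" where
  "orbit_rel = {(p, q). \<exists>A\<in>SL2Z. q = act A p}"


section \<open>From pairs of paths to tilings\<close>

definition is_lift :: "(int \<Rightarrow> int) \<Rightarrow> (int \<Rightarrow> int) \<Rightarrow> bipath \<Rightarrow> bool" where
  "is_lift a b \<gamma> \<longleftrightarrow> (\<forall>i. reduced_rational (a i) (b i) (\<gamma> i)) \<and> (\<forall>i. a i * b (i+1) - a (i+1) * b i = 1)"

definition lift_tiling ::
  "(int \<Rightarrow> int) \<Rightarrow> (int \<Rightarrow> int) \<Rightarrow> (int \<Rightarrow> int) \<Rightarrow> (int \<Rightarrow> int) \<Rightarrow> tiling" where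
  "lift_tiling a b c d = (\<lambda>i j. a i * d j - b i * c j)"

text \<open>Lemmas \<open>Phi_tilde_eq\<close> and \<open>Phi_orbit\<close> below show that the descriptions in the next two
  definitions are proper, i.e. that the choices involved do not matter.\<close>

definition Phi_tilde :: "bipath \<times> bipath \<Rightarrow> tiling set" where
  "Phi_tilde p = (THE X. \<exists>a b c d. is_lift a b (fst p) \<and> is_lift c d (snd p) \<and>
     X = sign_rel `` {lift_tiling a b c d})"

definition Phi :: "(bipath \<times> bipath) set \<Rightarrow> tiling set" where
  "Phi X = the_elem (Phi_tilde ` X)"


section \<open>Cyclic order, clockwise paths and their limits\<close>

fun circ :: "real pinf \<Rightarrow> complex" where
  "circ (Fin x) = (\<i> * of_real x + 1) / (of_real x + \<i>)"
| "circ Infty = \<i>"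

text \<open>Clockwise order of three points of the unit circle: running clockwise (arguments decreasing)
  from \<open>p\<close>, one meets \<open>q\<close> and then \<open>r\<close> before returning to \<open>p\<close>. This forces the three points to
  be distinct.\<close>

definition cw3 :: "complex \<Rightarrow> complex \<Rightarrow> complex \<Rightarrow> bool" where
  "cw3 p q r \<longleftrightarrow> (\<exists>\<alpha> \<beta> \<theta>. p = cis \<alpha> \<and> q = cis \<beta> \<and> r = cis \<theta> \<and>
     \<alpha> > \<beta> \<and> \<beta> > \<theta> \<and> \<theta> > \<alpha> - 2 * pi)"

definition clockwise_on :: "'i::linorder set \<Rightarrow> ('i \<Rightarrow> real pinf) \<Rightarrow> bool" where
  "clockwise_on I v \<longleftrightarrow> inj_on v I \<and>
     (\<forall>i\<in>I. \<forall>j\<in>I. \<forall>k\<in>I. i < j \<and> j < k \<longrightarrow> cw3 (circ (v i)) (circ (v j)) (circ (v k)))"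

definition clockwise_list :: "real pinf list \<Rightarrow> bool" where
  "clockwise_list xs \<longleftrightarrow> clockwise_on {..<length xs} (\<lambda>i. xs ! i)"

definition real_path :: "bipath \<Rightarrow> int \<Rightarrow> real pinf" where
  "real_path \<gamma> i = map_pinf of_rat (\<gamma> i)"

definition clockwise_path :: "bipath \<Rightarrow> bool" where
  "clockwise_path \<gamma> \<longleftrightarrow> \<gamma> \<in> paths \<and> clockwise_on UNIV (real_path \<gamma>)"

definition forward_limit :: "bipath \<Rightarrow> real pinf \<Rightarrow> bool" where
  "forward_limit \<gamma> L \<longleftrightarrow> ((\<lambda>i. circ (real_path \<gamma> i)) \<longlongrightarrow> circ L) at_top"

definition backward_limit :: "bipath \<Rightarrow> real pinf \<Rightarrow> bool" where
  "backward_limit \<gamma> L \<longleftrightarrow> ((\<lambda>i. circ (real_path \<gamma> i)) \<longlongrightarrow> circ L) at_bot"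

text \<open>The points \<open>A, B, C, D\<close> (for \<open>\<gamma>\<^sub>-\<^sub>\<infinity>, \<gamma>\<^sub>\<infinity>, \<delta>\<^sub>-\<^sub>\<infinity>, \<delta>\<^sub>\<infinity>\<close>) are in clockwise order, where
  the coincidences \<open>B = C\<close> and \<open>A = D\<close>, but no others, are permitted.\<close>

definition limits_clockwise ::
  "real pinf \<Rightarrow> real pinf \<Rightarrow> real pinf \<Rightarrow> real pinf \<Rightarrow> bool" where
  "limits_clockwise A B C D \<longleftrightarrow>
     (if B = C \<and> A = D then A \<noteq> B
      else if B = C then clockwise_list [A, B, D]
      else if A = D then clockwise_list [A, B, C]
      else clockwise_list [A, B, C, D])"

definition PP_plus :: "(bipath \<times> bipath) set" where
  "PP_plus = {(\<gamma>, \<delta>). clockwise_path \<gamma> \<and> clockwise_path \<delta> \<and>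
     (\<exists>A B C D. backward_limit \<gamma> A \<and> forward_limit \<gamma> B \<and>
        backward_limit \<delta> C \<and> forward_limit \<delta> D \<and> limits_clockwise A B C D)}"


section \<open>Well-definedness\<close>

lemma equiv_sign_rel: "equiv UNIV sign_rel"
  by (auto simp: equiv_def refl_on_def sym_def trans_def sign_rel_def)

lemma tame_alt:
  "tame M \<longleftrightarrow> (\<forall>i j.
     M i j * (M (i+1) (j+1) * M (i+2) (j+2) - M (i+1) (j+2) * M (i+2) (j+1))
   - M i (j+1) * (M (i+1) j * M (i+2) (j+2) - M (i+1) (j+2) * M (i+2) j)
   + M i (j+2) * (M (i+1) j * M (i+2) (j+1) - M (i+1) (j+1) * M (i+2) j) = 0)"
  unfolding tame_def by (simp add: det_3 algebra_simps)

lemma positive_imp_tame: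
  assumes "sl2_tiling M" "\<forall>i j. M i j > 0"
  shows "tame M"
  unfolding tame_alt
proof (intro allI)
  fix i j :: int
  have e: "M i j * M (i+1) (j+1) - M i (j+1) * M (i+1) j = 1" for i j
    using assms(1) by (simp add: sl2_tiling_def)
  have two: "i + 1 + 1 = i + 2" "j + 1 + 1 = j + 2" by simp_all
  note e1 = e[of i j] e[of "i+1" j, unfolded two] e[of i "j+1", unfolded two]
    e[of "i+1" "j+1", unfolded two]
  have "M (i+1) (j+1) *
   (M i j * (M (i+1) (j+1) * M (i+2) (j+2) - M (i+1) (j+2) * M (i+2) (j+1))
   - M i (j+1) * (M (i+1) j * M (i+2) (j+2) - M (i+1) (j+2) * M (i+2) j)
   + M i (j+2) * (M (i+1) j * M (i+2) (j+1) - M (i+1) (j+1) * M (i+2) j)) = 0"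
    using e1 by algebra
  moreover have "M (i+1) (j+1) \<noteq> 0"
    using assms(2) by (metis less_irrefl)
  ultimately show "M i j * (M (i+1) (j+1) * M (i+2) (j+2) - M (i+1) (j+2) * M (i+2) (j+1))
   - M i (j+1) * (M (i+1) j * M (i+2) (j+2) - M (i+1) (j+2) * M (i+2) j)
   + M i (j+2) * (M (i+1) j * M (i+2) (j+1) - M (i+1) (j+1) * M (i+2) j) = 0"
    by simp
qed

lemma SL2_plus_subset: "SL2_plus \<subseteq> SL2_tame"
  using positive_imp_tame by (auto simp: SL2_plus_def SL2_tame_def quotient_def)

lemma lift_tiling_tame:
  assumes "is_lift a b \<gamma>" "is_lift c d \<delta>"
  shows "sl2_tiling (lift_tiling a b c d)" "tame (lift_tiling a b c d)"
proof -
  have "(a i * d j - b i * c j) * (a (i+1) * d (j+1) - b (i+1) * c (j+1)) -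
        (a i * d (j+1) - b i * c (j+1)) * (a (i+1) * d j - b (i+1) * c j) = 1" for i j
  proof -
    have "a i * b (i+1) - a (i+1) * b i = 1" "c j * d (j+1) - c (j+1) * d j = 1"
      using assms by (auto simp: is_lift_def)
    then show ?thesis by algebra
  qed
  then show "sl2_tiling (lift_tiling a b c d)"
    by (simp add: sl2_tiling_def lift_tiling_def)
  show "tame (lift_tiling a b c d)"
    unfolding tame_alt lift_tiling_def by (intro allI) algebra
qed

lemma reduced_uminus: "reduced_rational a b v \<Longrightarrow> reduced_rational (- a) (- b) v"
  by (auto simp: reduced_rational_def)

lemma reduced_unique:
  assumes "reduced_rational a b v" "reduced_rational c d v"
  shows "(c = a \<and> d = b) \<or> (c = - a \<and> d = - b)"
proof (cases "b = 0")
  case True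
  then have "d = 0" using assms by (auto simp: reduced_rational_def split: if_splits)
  with True assms show ?thesis by (auto simp: reduced_rational_def zdvd1_eq abs_if split: if_splits)
next
  case False
  then have d: "d \<noteq> 0" using assms by (auto simp: reduced_rational_def split: if_splits)
  with False assms have "(of_int a / of_int b :: rat) = of_int c / of_int d"
    by (auto simp: reduced_rational_def)
  then have "(of_int (a * d) :: rat) = of_int (c * b)"
    using False d by (simp add: field_simps)
  then have e: "a * d = c * b" by (simp only: of_int_eq_iff)
  have "coprime a b" "coprime c d" using assms by (auto simp: reduced_rational_def)
  then have "b dvd d" "d dvd b"
    using e by (metis coprime_commute coprime_dvd_mult_right_iff dvd_triv_right,
                metis coprime_commute coprime_dvd_mult_right_iff dvd_triv_right)
  then have "\<bar>b\<bar> = \<bar>d\<bar>" by (rule zdvd_antisym_abs)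
  then have "d = b \<or> d = - b" by linarith
  then show ?thesis
  proof
    assume "d = b"
    then have "c = a" using e d by simp
    then show ?thesis using \<open>d = b\<close> by simp
  next
    assume *: "d = - b"
    then have "c * b = (- a) * b" using e by simp
    then have "c = - a" using False by (simp only: mult_cancel_right simp_thms)
    then show ?thesis using * by simp
  qed
qed

lemma lift_exists:
  assumes "\<gamma> \<in> paths"
  shows "\<exists>a b. is_lift a b \<gamma>"
proof -
  have "\<exists>a b. reduced_rational a b (\<gamma> i)" for i
    using assms unfolding paths_def farey_adj_def by blast
  then obtain p q where pq: "\<And>i. reduced_rational (p i) (q i) (\<gamma> i)" by metis
  define e where "e i = p i * q (i+1) - p (i+1) * q i" for i
  have e: "e i * e i = 1" for i
  proof -
    obtain a b c d where r: "reduced_rational a b (\<gamma> i)" "reduced_rational c d (\<gamma> (i+1))"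
      and "a * d - b * c = 1 \<or> a * d - b * c = -1"
      using assms unfolding paths_def farey_adj_def by blast
    moreover note reduced_unique[OF pq r(1)] reduced_unique[OF pq r(2)]
    ultimately have "e i = 1 \<or> e i = -1"
      unfolding e_def by (auto simp: algebra_simps)
    then show ?thesis by auto
  qed
  define s where "s i = (\<Prod>k\<in>{0..<i}. e k) * (\<Prod>k\<in>{i..<0}. e k)" for i :: int
  have s: "s (i+1) = e i * s i" for i
  proof (cases "i \<ge> 0")
    case True
    then have "{0..<i+1} = insert i {0..<i}" by auto
    then show ?thesis using True by (simp add: s_def)
  next
    case False
    then have "{i..<0} = insert i {i+1..<0}" by auto
    then have "s i = e i * s (i+1)" using False by (simp add: s_def)
    then have "e i * s i = (e i * e i) * s (i+1)" by (simp only: mult.assoc)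
    then show ?thesis using e[of i] by simp
  qed
  have s2: "s i * s i = 1" for i
  proof -
    have "s i * s i = (\<Prod>k\<in>{0..<i}. e k * e k) * (\<Prod>k\<in>{i..<0}. e k * e k)"
      by (simp add: s_def prod.distrib algebra_simps)
    then show ?thesis by (simp add: e)
  qed
  have "is_lift (\<lambda>i. s i * p i) (\<lambda>i. s i * q i) \<gamma>"
    unfolding is_lift_def
  proof (intro conjI allI)
    fix i
    have "s i = 1 \<or> s i = -1" using s2[of i] by (simp add: square_eq_1_iff)
    then show "reduced_rational (s i * p i) (s i * q i) (\<gamma> i)"
      using pq[of i] reduced_uminus by auto
    have "s i * p i * (s (i+1) * q (i+1)) - s (i+1) * p (i+1) * (s i * q i) = (s i * s (i+1)) * e i"
      by (simp add: e_def algebra_simps)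
    also have "\<dots> = (s i * s i) * (e i * e i)" by (simp only: s mult.assoc mult.commute mult.left_commute)
    also have "\<dots> = 1" using s2[of i] e[of i] by simp
    finally show "s i * p i * (s (i+1) * q (i+1)) - s (i+1) * p (i+1) * (s i * q i) = 1" .
  qed
  then show ?thesis by blast
qed

lemma lift_unique:
  assumes "is_lift a b \<gamma>" "is_lift c d \<gamma>"
  shows "(c = a \<and> d = b) \<or> (c = (\<lambda>i. - a i) \<and> d = (\<lambda>i. - b i))"
proof -
  have "\<exists>\<sigma>\<in>{1,-1}. c i = \<sigma> * a i \<and> d i = \<sigma> * b i" for i
    using reduced_unique[of "a i" "b i" "\<gamma> i" "c i" "d i"] assms by (auto simp: is_lift_def)
  then obtain \<sigma> :: "int \<Rightarrow> int" where \<sigma>: "\<And>i. \<sigma> i \<in> {1,-1}"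
    "\<And>i. c i = \<sigma> i * a i" "\<And>i. d i = \<sigma> i * b i" by metis
  have step: "\<sigma> (i+1) = \<sigma> i" for i
  proof -
    have "a i * b (i+1) - a (i+1) * b i = 1" "c i * d (i+1) - c (i+1) * d i = 1"
      using assms by (auto simp: is_lift_def)
    then have "\<sigma> i * \<sigma> (i+1) = 1" unfolding \<sigma>(2,3) by algebra
    then show ?thesis using \<sigma>(1)[of i] \<sigma>(1)[of "i+1"] by auto
  qed
  have "\<sigma> i = \<sigma> 0" for i
  proof (induction i rule: int_induct[where k = 0])
    case (step1 i) then show ?case using step[of i] by simp
  next
    case (step2 i) then show ?case using step[of "i - 1"] by simp
  qed simp
  then have "c i = \<sigma> 0 * a i \<and> d i = \<sigma> 0 * b i" for i using \<sigma>(2,3) by metis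
  then show ?thesis using \<sigma>(1)[of 0] by auto
qed

lemma Phi_tilde_eq:
  assumes "is_lift a b \<gamma>" "is_lift c d \<delta>"
  shows "Phi_tilde (\<gamma>, \<delta>) = sign_rel `` {lift_tiling a b c d}"
  unfolding Phi_tilde_def
proof (rule the_equality)
  show "\<exists>a' b' c' d'. is_lift a' b' (fst (\<gamma>, \<delta>)) \<and> is_lift c' d' (snd (\<gamma>, \<delta>)) \<and>
     sign_rel `` {lift_tiling a b c d} = sign_rel `` {lift_tiling a' b' c' d'}"
    using assms by auto
next
  fix X
  assume "\<exists>a b c d. is_lift a b (fst (\<gamma>, \<delta>)) \<and> is_lift c d (snd (\<gamma>, \<delta>)) \<and>
     X = sign_rel `` {lift_tiling a b c d}"
  then obtain a' b' c' d' where l: "is_lift a' b' \<gamma>" "is_lift c' d' \<delta>"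
    and X: "X = sign_rel `` {lift_tiling a' b' c' d'}" by auto
  have "(lift_tiling a b c d, lift_tiling a' b' c' d') \<in> sign_rel"
    using lift_unique[OF assms(1) l(1)] lift_unique[OF assms(2) l(2)]
    by (auto simp: sign_rel_def lift_tiling_def fun_eq_iff)
  then show "X = sign_rel `` {lift_tiling a b c d}"
    unfolding X using equiv_class_eq[OF equiv_sign_rel] by metis
qed

lemma reduced_moebius:
  assumes "A \<in> SL2Z" "reduced_rational a b v"
  shows "reduced_rational (A$1$1 * a + A$1$2 * b) (A$2$1 * a + A$2$2 * b) (moebius A v)"
proof -
  have det: "A$1$1 * A$2$2 - A$1$2 * A$2$1 = 1"
    using assms(1) by (simp add: SL2Z_def det_2)
  have cop: "coprime (A$1$1 * a + A$1$2 * b) (A$2$1 * a + A$2$2 * b)"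
  proof (rule coprimeI)
    fix k assume k: "k dvd A$1$1 * a + A$1$2 * b" "k dvd A$2$1 * a + A$2$2 * b"
    have "A$2$2 * (A$1$1 * a + A$1$2 * b) - A$1$2 * (A$2$1 * a + A$2$2 * b)
        = (A$1$1 * A$2$2 - A$1$2 * A$2$1) * a"
      "A$1$1 * (A$2$1 * a + A$2$2 * b) - A$2$1 * (A$1$1 * a + A$1$2 * b)
        = (A$1$1 * A$2$2 - A$1$2 * A$2$1) * b"
      by (simp_all add: algebra_simps)
    moreover have "k dvd A$2$2 * (A$1$1 * a + A$1$2 * b) - A$1$2 * (A$2$1 * a + A$2$2 * b)"
      "k dvd A$1$1 * (A$2$1 * a + A$2$2 * b) - A$2$1 * (A$1$1 * a + A$1$2 * b)"
      by (intro dvd_diff dvd_mult k)+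
    ultimately have "k dvd a" "k dvd b" unfolding det by simp_all
    then show "is_unit k" using assms(2) by (auto simp: reduced_rational_def coprime_def)
  qed
  show ?thesis
  proof (cases "b = 0")
    case True
    then have "v = Infty" "a = 1 \<or> a = -1"
      using assms(2) by (auto simp: reduced_rational_def zdvd1_eq abs_if split: if_splits)
    then show ?thesis using cop True by (auto simp: reduced_rational_def)
  next
    case False
    then have v: "v = Fin (of_int a / of_int b)" using assms(2) by (simp add: reduced_rational_def)
    have e: "of_int x * (of_int a / of_int b) + of_int y = (of_int (x * a + y * b) / of_int b :: rat)"
      for x y using False by (simp add: field_simps)
    show ?thesis using cop False unfolding v reduced_rational_def moebius.simps e by (simp del: of_int_add of_int_mult)
  qed
qed

lemma is_lift_moebius:
  assumes "A \<in> SL2Z" "is_lift a b \<gamma>"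
  shows "is_lift (\<lambda>i. A$1$1 * a i + A$1$2 * b i) (\<lambda>i. A$2$1 * a i + A$2$2 * b i) (moebius A \<circ> \<gamma>)"
proof -
  have det: "A$1$1 * A$2$2 - A$1$2 * A$2$1 = 1"
    using assms(1) by (simp add: SL2Z_def det_2)
  have "(A$1$1 * a i + A$1$2 * b i) * (A$2$1 * a (i+1) + A$2$2 * b (i+1)) -
     (A$1$1 * a (i+1) + A$1$2 * b (i+1)) * (A$2$1 * a i + A$2$2 * b i) = 1" for i
  proof -
    have "a i * b (i+1) - a (i+1) * b i = 1" using assms(2) by (auto simp: is_lift_def)
    then show ?thesis using det by algebra
  qed
  then show ?thesis using assms reduced_moebius by (auto simp: is_lift_def)
qed

lemma Phi_tilde_act:
  assumes "A \<in> SL2Z" "p \<in> paths \<times> paths"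
  shows "Phi_tilde (act A p) = Phi_tilde p"
proof -
  obtain \<gamma> \<delta> where p: "p = (\<gamma>, \<delta>)" by (cases p)
  obtain a b c d where l: "is_lift a b \<gamma>" "is_lift c d \<delta>"
    using assms(2) lift_exists unfolding p by blast
  have det: "A$1$1 * A$2$2 - A$1$2 * A$2$1 = 1"
    using assms(1) by (simp add: SL2Z_def det_2)
  have "lift_tiling (\<lambda>i. A$1$1 * a i + A$1$2 * b i) (\<lambda>i. A$2$1 * a i + A$2$2 * b i)
     (\<lambda>i. A$1$1 * c i + A$1$2 * d i) (\<lambda>i. A$2$1 * c i + A$2$2 * d i) = lift_tiling a b c d"
    unfolding lift_tiling_def by (intro ext) (use det in algebra)
  then show ?thesis
    using Phi_tilde_eq[OF l] Phi_tilde_eq[OF is_lift_moebius[OF assms(1) l(1)] is_lift_moebius[OF assms(1) l(2)]]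
    by (simp add: p act_def)
qed

lemma moebius_id: "moebius (mat 1) v = v"
  by (cases v) (auto simp: mat_def)

lemma Phi_orbit:
  assumes "p \<in> paths \<times> paths"
  shows "Phi (orbit_rel `` {p}) = Phi_tilde p"
proof -
  have "p = act (mat 1) p" by (simp add: act_def moebius_id comp_def)
  moreover have "mat 1 \<in> SL2Z" by (simp add: SL2Z_def)
  ultimately have "p \<in> orbit_rel `` {p}" unfolding orbit_rel_def by blast
  moreover have "Phi_tilde q = Phi_tilde p" if "q \<in> orbit_rel `` {p}" for q
    using that Phi_tilde_act[OF _ assms] by (auto simp: orbit_rel_def)
  ultimately have "Phi_tilde ` (orbit_rel `` {p}) = {Phi_tilde p}" by blast
  then show ?thesis by (simp add: Phi_def)
qed

end

theory Submission
  imports Defs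
begin

text \<open>
  Write the lifts of \<open>\<gamma>\<close> and \<open>\<delta>\<close> as plane vectors \<open>v\<^sub>i = (a\<^sub>i, b\<^sub>i)\<close> and \<open>w\<^sub>j = (c\<^sub>j, d\<^sub>j)\<close>, so that the
  tiling is \<open>m\<^sub>i\<^sub>j = det (v\<^sub>i, w\<^sub>j)\<close>. A vector with polar angle \<open>\<phi>\<close> represents the point of the circle with
  argument \<open>\<pi>/2 - 2\<phi>\<close>, so clockwise on the circle means counterclockwise in the plane. A path is
  clockwise iff \<open>det (v\<^sub>i, v\<^sub>j) > 0\<close> for all \<open>i < j\<close>, which means that its polar angles can be chosen
  increasing with total spread at most \<open>\<pi>\<close>; they then run through an interval with ends \<open>L\<close> and \<open>U\<close>,
  which represent the limit points. Up to adding a multiple of \<open>\<pi>\<close> to the angles of \<open>\<delta>\<close>, the limit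
  points are in the required order iff \<open>L\<^sub>\<gamma> < U\<^sub>\<gamma> \<le> L\<^sub>\<delta> < U\<^sub>\<delta> \<le> L\<^sub>\<gamma> + \<pi>\<close>, and this is equivalent to
  all \<open>m\<^sub>i\<^sub>j\<close> having the same sign.

  Conversely, a positive tiling equals \<open>det (v\<^sub>i, w\<^sub>j)\<close> for \<open>w\<^sub>0 = (1, 0)\<close>, \<open>w\<^sub>1 = (0, 1)\<close>, and the matrix
  taking \<open>v\<^sub>0, v\<^sub>1\<close> to the corresponding vectors of another representation identifies the two.
\<close>

section \<open>Angles\<close>

definition line_pt :: "real \<Rightarrow> complex" where
  "line_pt \<phi> = cis (pi / 2 - 2 * \<phi>)"

text \<open>Multiplying through by \<open>sin \<phi>\<close> turns numerator and denominator of
  \<open>circ\<close> into \<open>\<i> * cis (- \<phi>)\<close> and \<open>cis \<phi>\<close>, whose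
  quotient has argument \<open>pi / 2 - 2 * \<phi>\<close>.\<close>

lemma circ_cot: "circ (if sin \<phi> = 0 then Infty else Fin (cos \<phi> / sin \<phi>)) = line_pt \<phi>"
proof (cases "sin \<phi> = 0")
  case True
  then have "cos (2 * \<phi>) = 1" "sin (2 * \<phi>) = 0"
    by (simp_all add: cos_double_sin sin_double)
  then show ?thesis
    using True by (simp add: line_pt_def complex_eq_iff cos_diff sin_diff)
next
  case False
  have ne: "cis \<phi> \<noteq> 0" by simp
  have "\<i> * of_real (cos \<phi> / sin \<phi>) + 1 = \<i> * cis (- \<phi>) / sin \<phi>"
    "of_real (cos \<phi> / sin \<phi>) + \<i> = cis \<phi> / sin \<phi>"
    using False by (simp_all add: complex_eq_iff)
  then have "circ (Fin (cos \<phi> / sin \<phi>)) = \<i> * cis (- \<phi>) / cis \<phi>"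
    using False by simp
  also have "\<dots> = cis (pi / 2) * cis (- \<phi>) / cis \<phi>" by simp
  also have "\<dots> = line_pt \<phi>"
    unfolding line_pt_def cis_mult cis_divide by (rule arg_cong[of _ _ cis]) simp
  finally show ?thesis using False by simp
qed

lemma circ_reduced_rational:
  assumes "reduced_rational a b v" "r > 0" "real_of_int a = r * cos \<phi>" "real_of_int b = r * sin \<phi>"
  shows "circ (map_pinf of_rat v) = line_pt \<phi>"
proof -
  have "sin \<phi> = 0 \<longleftrightarrow> b = 0" using assms by auto
  moreover have "real_of_int a / real_of_int b = cos \<phi> / sin \<phi>" using assms by simp
  ultimately have "map_pinf of_rat v = (if sin \<phi> = 0 then Infty else Fin (cos \<phi> / sin \<phi>))"
    using assms(1) by (auto simp: reduced_rational_def of_rat_divide)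
  then show ?thesis using circ_cot by metis
qed

lemma circ_inj: "circ A = circ B \<longleftrightarrow> A = B"
proof -
  have nz: "complex_of_real x + \<i> \<noteq> 0" for x by (simp add: complex_eq_iff)
  have "x = y" if "circ (Fin x) = circ (Fin y)" for x y
  proof -
    have "(\<i> * of_real x + 1) * (of_real y + \<i>) = (\<i> * of_real y + 1) * (of_real x + \<i>)"
      using that nz[of x] nz[of y] by (simp add: frac_eq_eq)
    then show ?thesis by (simp add: complex_eq_iff)
  qed
  moreover have "circ (Fin x) \<noteq> \<i>" for x
    using nz[of x] by (simp add: divide_eq_eq) (simp add: complex_eq_iff)
  ultimately show ?thesis by (cases A; cases B) (auto simp del: circ.simps(1), (metis circ.simps)+)
qed

section \<open>Coincidence of points in terms of angles\<close>

lemma line_pt_shift: "line_pt (\<phi> + of_int k * pi) = line_pt \<phi>"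
proof -
  have "cis (pi / 2 - 2 * \<phi> - 2 * pi * of_int k) = cis (pi / 2 - 2 * \<phi>)"
    by (simp add: complex_eq_iff cos_diff sin_diff)
  then show ?thesis by (simp add: line_pt_def algebra_simps)
qed

lemma line_pt_eqD:
  assumes "line_pt \<phi> = line_pt \<psi>"
  shows "sin (\<psi> - \<phi>) = 0"
proof -
  have "line_pt \<phi> / line_pt \<psi> = 1" using assms by (simp add: line_pt_def)
  then have "cis (2 * (\<psi> - \<phi>)) = 1"
    unfolding line_pt_def cis_divide by (simp add: algebra_simps)
  then have "cos (2 * (\<psi> - \<phi>)) = 1" by (metis cis.sel(1) one_complex.sel(1))
  then show ?thesis unfolding cos_double_sin by simp
qed

lemma line_pt_neq:
  assumes "\<phi> < \<psi>" "\<psi> < \<phi> + pi"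
  shows "line_pt \<phi> \<noteq> line_pt \<psi>"
  using line_pt_eqD[of \<phi> \<psi>] sin_gt_zero[of "\<psi> - \<phi>"] assms by auto

lemma line_pt_eq_iff:
  assumes "\<phi> < \<psi>" "\<psi> \<le> \<phi> + pi"
  shows "line_pt \<phi> = line_pt \<psi> \<longleftrightarrow> \<psi> = \<phi> + pi"
proof
  assume "line_pt \<phi> = line_pt \<psi>"
  then show "\<psi> = \<phi> + pi" using line_pt_neq[of \<phi> \<psi>] assms by linarith
next
  assume "\<psi> = \<phi> + pi"
  then show "line_pt \<phi> = line_pt \<psi>" using line_pt_shift[of \<phi> 1] by simp
qed

section \<open>Orientation of three points\<close>

text \<open>The factor -2 in \<open>line_pt\<close> turns increasing angles into decreasing
  arguments, and a spread below \<open>pi\<close> into one below \<open>2 * pi\<close>.\<close>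

lemma cw3_line_ptI:
  assumes "\<phi> < \<psi>" "\<psi> < \<tau>" "\<tau> < \<phi> + pi"
  shows "cw3 (line_pt \<phi>) (line_pt \<psi>) (line_pt \<tau>)"
proof -
  have "pi / 2 - 2 * \<phi> > pi / 2 - 2 * \<psi>" "pi / 2 - 2 * \<psi> > pi / 2 - 2 * \<tau>"
    "pi / 2 - 2 * \<tau> > pi / 2 - 2 * \<phi> - 2 * pi"
    using assms by simp_all
  then show ?thesis unfolding cw3_def line_pt_def by blast
qed

text \<open>Evaluates, in \<open>area_cis\<close>, twice the signed area of a triangle inscribed in
  the unit circle; \<open>x\<close> and \<open>y\<close> are half the arcs between consecutive
  vertices.\<close>

lemma sine_triple_product:
  fixes x y :: real
  shows "4 * (sin x * sin y * sin (x + y)) = sin (2 * x) + sin (2 * y) - sin (2 * (x + y))"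
proof -
  have "sin x ^ 2 + cos x ^ 2 = 1" "sin y ^ 2 + cos y ^ 2 = 1" by simp_all
  then show ?thesis unfolding sin_double sin_add cos_add by algebra
qed

text \<open>The left-hand side depends only on the three points, so the sign of the product of sines does
  not depend on the angles chosen to represent them.\<close>

lemma area_cis:
  "Im (cis \<alpha> * cnj (cis \<beta>) + cis \<beta> * cnj (cis \<theta>) + cis \<theta> * cnj (cis \<alpha>))
     = 4 * (sin ((\<alpha> - \<beta>) / 2) * sin ((\<beta> - \<theta>) / 2) * sin ((\<alpha> - \<theta>) / 2))"
proof -
  have half: "(\<alpha> - \<beta>) / 2 + (\<beta> - \<theta>) / 2 = (\<alpha> - \<theta>) / 2" "2 * (x / 2) = x" for x :: real
    by (simp_all add: field_simps)
  have "4 * (sin ((\<alpha> - \<beta>) / 2) * sin ((\<beta> - \<theta>) / 2) * sin ((\<alpha> - \<theta>) / 2))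
     = sin (\<alpha> - \<beta>) + sin (\<beta> - \<theta>) - sin (\<alpha> - \<theta>)"
    using sine_triple_product[of "(\<alpha> - \<beta>) / 2" "(\<beta> - \<theta>) / 2"] unfolding half .
  then show ?thesis by (simp add: sin_diff algebra_simps)
qed

text \<open>The arguments witnessing \<open>cw3\<close> may differ from those in
  \<open>line_pt\<close>, but the area of the triangle is the same for both choices. For arbitrary
  angles only the sign of the product survives, not their order.\<close>

lemma cw3_line_ptD:
  assumes "cw3 (line_pt \<phi>) (line_pt \<psi>) (line_pt \<tau>)"
  shows "sin (\<psi> - \<phi>) * sin (\<tau> - \<psi>) * sin (\<tau> - \<phi>) > 0"
proof -
  obtain \<alpha> \<beta> \<theta> where e: "line_pt \<phi> = cis \<alpha>" "line_pt \<psi> = cis \<beta>" "line_pt \<tau> = cis \<theta>"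
    and o: "\<alpha> > \<beta>" "\<beta> > \<theta>" "\<theta> > \<alpha> - 2 * pi"
    using assms unfolding cw3_def by blast
  have "sin ((\<alpha> - \<beta>) / 2) * sin ((\<beta> - \<theta>) / 2) * sin ((\<alpha> - \<theta>) / 2) > 0"
    using o by (intro mult_pos_pos sin_gt_zero) simp_all
  then have "Im (cis \<alpha> * cnj (cis \<beta>) + cis \<beta> * cnj (cis \<theta>) + cis \<theta> * cnj (cis \<alpha>)) > 0"
    unfolding area_cis by simp
  then have "Im (cis (pi / 2 - 2 * \<phi>) * cnj (cis (pi / 2 - 2 * \<psi>))
      + cis (pi / 2 - 2 * \<psi>) * cnj (cis (pi / 2 - 2 * \<tau>))
      + cis (pi / 2 - 2 * \<tau>) * cnj (cis (pi / 2 - 2 * \<phi>))) > 0"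
    unfolding e[symmetric] line_pt_def .
  moreover have half: "((pi / 2 - 2 * x) - (pi / 2 - 2 * y)) / 2 = y - x" for x y :: real by simp
  ultimately have "4 * (sin (\<psi> - \<phi>) * sin (\<tau> - \<psi>) * sin (\<tau> - \<phi>)) > 0"
    unfolding area_cis half by blast
  then show ?thesis by linarith
qed

section \<open>Locating angles by the sign of a sine\<close>

text \<open>The window from \<open>- pi\<close> to \<open>2 * pi\<close> contains just one interval
  on which sine is positive. So a crude bound on a difference of angles and the sign of a
  determinant locate the difference.\<close>

lemma sin_pos_range:
  assumes "sin x > 0" "- pi \<le> x" "x \<le> 2 * pi"
  shows "0 < x \<and> x < pi"
proof -
  have "x > 0" using sin_ge_zero[of "- x"] assms by (cases "x > 0") auto
  moreover have "x < pi"
    using sin_ge_zero[of "x - pi"] assms by (cases "x < pi") (auto simp: sin_diff)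
  ultimately show ?thesis by simp
qed

lemma sin_zero_range:
  assumes "sin x = 0" "0 < x" "x < 2 * pi"
  shows "x = pi"
proof (rule ccontr)
  assume "x \<noteq> pi"
  then consider "x < pi" | "x > pi" by linarith
  then show False
    using sin_gt_zero[of x] sin_gt_zero[of "x - pi"] assms by cases (auto simp: sin_diff)
qed

text \<open>\<open>Arg\<close> takes values above \<open>- pi\<close> and up to \<open>pi\<close>;
  rotating by \<open>- t\<close> first centres that window at \<open>t\<close>.\<close>

lemma polar_near:
  assumes "x \<noteq> 0 \<or> y \<noteq> 0"
  obtains r \<phi> where "r > 0" "x = r * cos \<phi>" "y = r * sin \<phi>" "t - pi < \<phi>" "\<phi> \<le> t + pi"
proof -
  define z where "z = Complex x y"
  define w where "w = z * cis (- t)"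
  have "z \<noteq> 0" using assms by (auto simp: z_def complex_eq_iff)
  then have w: "w \<noteq> 0" by (simp add: w_def)
  have "z = w * cis t" by (simp add: w_def cis_mult mult.assoc)
  also have "\<dots> = rcis (cmod w) (Arg w) * cis t" by (simp add: rcis_cmod_Arg)
  also have "\<dots> = rcis (cmod w) (Arg w + t)" by (simp add: rcis_def cis_mult mult.assoc)
  finally have "x = cmod w * cos (Arg w + t)" "y = cmod w * sin (Arg w + t)"
    by (simp_all add: z_def complex_eq_iff)
  with that[of "cmod w" "Arg w + t"] w Arg_bounded[of w] show thesis by auto
qed

lemma det_polar:
  fixes a b c d :: int
  assumes "real_of_int a = r * cos \<phi>" "real_of_int b = r * sin \<phi>"
    "real_of_int c = s * cos \<psi>" "real_of_int d = s * sin \<psi>"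
  shows "real_of_int (a * d - b * c) = r * s * sin (\<psi> - \<phi>)"
  using assms by (simp add: sin_diff algebra_simps)

lemma det_polar_pos:
  fixes a b c d :: int
  assumes "r > 0" "s > 0" "real_of_int a = r * cos \<phi>" "real_of_int b = r * sin \<phi>"
    "real_of_int c = s * cos \<psi>" "real_of_int d = s * sin \<psi>"
  shows "a * d - b * c > 0 \<longleftrightarrow> sin (\<psi> - \<phi>) > 0"
proof -
  have "a * d - b * c > 0 \<longleftrightarrow> real_of_int (a * d - b * c) > 0" by linarith
  then show ?thesis unfolding det_polar[OF assms(3-6)] using mult_pos_pos[OF assms(1,2)] by (simp only: zero_less_mult_iff[of "r * s"]) auto
qed


section \<open>Clockwise paths\<close>

lemma is_lift_nonzero: "is_lift a b \<gamma> \<Longrightarrow> a i \<noteq> 0 \<or> b i \<noteq> 0"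
  by (metis is_lift_def diff_self mult_zero_left mult_zero_right zero_neq_one)

lemma is_lift_path: "is_lift a b \<gamma> \<Longrightarrow> \<gamma> \<in> paths"
  unfolding is_lift_def paths_def farey_adj_def by (auto simp: mult.commute) (metis mult.commute)

text \<open>Induction on \<open>j\<close>, starting from the consecutive determinants, which are 1.
  For the clockwise triple \<open>i\<close>, \<open>j\<close>, \<open>j + 1\<close> the product of
  the three sines is positive, and the induction hypothesis and the lift condition make two of them
  positive.\<close>

lemma clockwise_path_det_pos:
  assumes lift: "is_lift a b \<gamma>" and cw: "clockwise_path \<gamma>" and ij: "i < j"
  shows "a i * b j - b i * a j > 0"
proof -
  have "\<exists>r \<phi>. r > 0 \<and> real_of_int (a i) = r * cos \<phi> \<and> real_of_int (b i) = r * sin \<phi>" for i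
    using polar_near[of "a i" "b i"] is_lift_nonzero[OF lift, of i] by (metis of_int_eq_0_iff)
  then obtain r \<phi> where p: "\<And>i. r i > 0" "\<And>i. real_of_int (a i) = r i * cos (\<phi> i)"
    "\<And>i. real_of_int (b i) = r i * sin (\<phi> i)" by metis
  have circ: "circ (real_path \<gamma> i) = line_pt (\<phi> i)" for i
    unfolding real_path_def by (rule circ_reduced_rational[OF _ p]) (use lift in \<open>auto simp: is_lift_def\<close>)
  have sin: "a i * b j - b i * a j > 0 \<longleftrightarrow> sin (\<phi> j - \<phi> i) > 0" for i j
    by (rule det_polar_pos[OF p(1,1,2,3,2,3)])
  have step: "a k * b (k+1) - b k * a (k+1) > 0" for k
    using lift by (auto simp: is_lift_def mult.commute[of "b k"])
  show ?thesis
    using ij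
  proof (induction j rule: int_gr_induct)
    case base
    show ?case by (rule step)
  next
    case step2: (step j)
    then have "cw3 (circ (real_path \<gamma> i)) (circ (real_path \<gamma> j)) (circ (real_path \<gamma> (j+1)))"
      using cw unfolding clockwise_path_def clockwise_on_def by auto
    then have "sin (\<phi> j - \<phi> i) * sin (\<phi> (j+1) - \<phi> j) * sin (\<phi> (j+1) - \<phi> i) > 0"
      unfolding circ by (rule cw3_line_ptD)
    then show ?case
      using step2 step[of j] unfolding sin by (metis zero_less_mult_pos mult_pos_pos)
  qed
qed

text \<open>All angles are first taken within \<open>pi\<close> of the one at index 0. Determinants
  with index 0 then put positive indices above it and negative ones below, which confines every
  difference to the window of \<open>sin_pos_range\<close>.\<close>

lemma angles_of_lift:
  assumes lift: "is_lift a b \<gamma>" and pos: "\<And>i j. i < j \<Longrightarrow> a i * b j - b i * a j > 0"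
  obtains r \<phi> where "\<And>i. r i > 0" "\<And>i. real_of_int (a i) = r i * cos (\<phi> i)"
    "\<And>i. real_of_int (b i) = r i * sin (\<phi> i)"
    "\<And>i j. i < j \<Longrightarrow> \<phi> i < \<phi> j \<and> \<phi> j < \<phi> i + pi" "t - pi < \<phi> 0" "\<phi> 0 \<le> t + pi"
    "\<And>i. circ (real_path \<gamma> i) = line_pt (\<phi> i)"
proof -
  have nz: "real_of_int (a i) \<noteq> 0 \<or> real_of_int (b i) \<noteq> 0" for i
    using is_lift_nonzero[OF lift, of i] by simp
  obtain r0 \<phi>0 where p0: "r0 > 0" "real_of_int (a 0) = r0 * cos \<phi>0"
    "real_of_int (b 0) = r0 * sin \<phi>0" "t - pi < \<phi>0" "\<phi>0 \<le> t + pi"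
    using polar_near[OF nz] by metis
  have "\<exists>r \<phi>. r > 0 \<and> real_of_int (a i) = r * cos \<phi> \<and> real_of_int (b i) = r * sin \<phi> \<and>
      \<phi>0 - pi < \<phi> \<and> \<phi> \<le> \<phi>0 + pi \<and> (i = 0 \<longrightarrow> \<phi> = \<phi>0)" for i
  proof (cases "i = 0")
    case True
    then show ?thesis using p0 pi_gt_zero by (intro exI[of _ r0] exI[of _ \<phi>0]) auto
  next
    case False
    then show ?thesis using polar_near[OF nz] by metis
  qed
  then obtain r \<phi> where p: "\<And>i. r i > 0" "\<And>i. real_of_int (a i) = r i * cos (\<phi> i)"
    "\<And>i. real_of_int (b i) = r i * sin (\<phi> i)"
    and rng: "\<And>i. \<phi>0 - pi < \<phi> i" "\<And>i. \<phi> i \<le> \<phi>0 + pi" and 0: "\<phi> 0 = \<phi>0" by metis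
  have sin: "sin (\<phi> j - \<phi> i) > 0" if "i < j" for i j
    using pos[OF that] det_polar_pos[OF p(1,1,2,3,2,3)] by metis
  have gt: "0 < \<phi> i - \<phi>0 \<and> \<phi> i - \<phi>0 < pi" if "0 < i" for i
    using sin_pos_range[of "\<phi> i - \<phi>0"] sin[OF that] rng[of i] pi_gt_zero unfolding 0 by linarith
  have lt: "0 < \<phi>0 - \<phi> i \<and> \<phi>0 - \<phi> i < pi" if "i < 0" for i
    using sin_pos_range[of "\<phi>0 - \<phi> i"] sin[OF that] rng[of i] pi_gt_zero unfolding 0 by linarith
  have "\<phi> i < \<phi> j \<and> \<phi> j < \<phi> i + pi" if "i < j" for i j
  proof -
    have "- pi \<le> \<phi> j - \<phi> i \<and> \<phi> j - \<phi> i \<le> 2 * pi"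
      using gt[of i] gt[of j] lt[of i] lt[of j] that 0 pi_gt_zero
      by (cases i "0 :: int" rule: linorder_cases; cases j "0 :: int" rule: linorder_cases) auto
    then show ?thesis using sin_pos_range[of "\<phi> j - \<phi> i"] sin[OF that] by linarith
  qed
  moreover have "circ (real_path \<gamma> i) = line_pt (\<phi> i)" for i
    unfolding real_path_def by (rule circ_reduced_rational[OF _ p]) (use lift in \<open>auto simp: is_lift_def\<close>)
  ultimately show thesis using that[of r \<phi>] p p0(4,5) 0 by blast
qed

lemma clockwise_pathI:
  assumes lift: "is_lift a b \<gamma>" and pos: "\<And>i j. i < j \<Longrightarrow> a i * b j - b i * a j > 0"
  shows "clockwise_path \<gamma>"
proof -
  obtain r \<phi> where mono: "\<And>i j. i < j \<Longrightarrow> \<phi> i < \<phi> j \<and> \<phi> j < \<phi> i + pi"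
    and circ: "\<And>i. circ (real_path \<gamma> i) = line_pt (\<phi> i)"
    using angles_of_lift[OF lift pos] by metis
  have "inj (real_path \<gamma>)"
    by (rule linorder_injI) (metis circ mono line_pt_neq)
  moreover have "cw3 (circ (real_path \<gamma> i)) (circ (real_path \<gamma> j)) (circ (real_path \<gamma> k))"
    if "i < j" "j < k" for i j k
    unfolding circ by (rule cw3_line_ptI) (use mono[of i j] mono[of j k] mono[of i k] that in auto)
  ultimately show ?thesis
    using is_lift_path[OF lift] by (simp add: clockwise_path_def clockwise_on_def)
qed

section \<open>Limits of paths through limits of angles\<close>

text \<open>Monotone convergence both ways: the limits are the infimum and supremum of the range,
  not attained because every index has neighbours on both sides.\<close>

lemma strict_mono_int_limits:
  fixes \<phi> :: "int \<Rightarrow> real"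
  assumes mono: "\<And>i j. i < j \<Longrightarrow> \<phi> i < \<phi> j \<and> \<phi> j < \<phi> i + c"
  obtains L U where "(\<phi> \<longlongrightarrow> L) at_bot" "(\<phi> \<longlongrightarrow> U) at_top" "\<And>i. L < \<phi> i" "\<And>i. \<phi> i < U"
proof -
  have c: "c > 0" using mono[of 0 1] by auto
  have bnd: "\<phi> i < \<phi> 0 + c" "\<phi> 0 - c < \<phi> i" for i
    using mono[of 0 i] mono[of i 0] c by (cases i "0 :: int" rule: linorder_cases; force)+
  have ba: "bdd_above (range \<phi>)" using bnd(1) by (intro bdd_aboveI[of _ "\<phi> 0 + c"]) (auto intro: less_imp_le)
  have bb: "bdd_below (range \<phi>)" using bnd(2) by (intro bdd_belowI[of _ "\<phi> 0 - c"]) (auto intro: less_imp_le)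
  have up: "\<phi> i < Sup (range \<phi>)" for i
    using cSup_upper[OF _ ba, of "\<phi> (i+1)"] mono[of i "i+1"] by auto
  have lo: "Inf (range \<phi>) < \<phi> i" for i
    using cInf_lower[OF _ bb, of "\<phi> (i-1)"] mono[of "i-1" i] by auto
  have le: "\<phi> i \<le> \<phi> j" if "i \<le> j" for i j
    using mono[of i j] that by (cases "i = j") auto
  have "(\<phi> \<longlongrightarrow> Sup (range \<phi>)) at_top"
  proof (rule increasing_tendsto)
    show "eventually (\<lambda>i. \<phi> i \<le> Sup (range \<phi>)) at_top" using up by (auto intro!: always_eventually less_imp_le)
    fix x assume "x < Sup (range \<phi>)"
    then obtain i where "x < \<phi> i" using ba by (auto simp: less_cSup_iff)
    then show "eventually (\<lambda>j. x < \<phi> j) at_top"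
      by (intro eventually_mono[OF eventually_ge_at_top[of i]]) (use le in force)
  qed
  moreover have "(\<phi> \<longlongrightarrow> Inf (range \<phi>)) at_bot"
  proof (rule decreasing_tendsto)
    show "eventually (\<lambda>i. Inf (range \<phi>) \<le> \<phi> i) at_bot" using lo by (auto intro!: always_eventually less_imp_le)
    fix x assume "Inf (range \<phi>) < x"
    then obtain i where "\<phi> i < x" using bb by (auto simp: cInf_less_iff)
    then show "eventually (\<lambda>j. \<phi> j < x) at_bot"
      by (intro eventually_mono[OF eventually_le_at_bot[of i]]) (use le in force)
  qed
  ultimately show thesis using that up lo by blast
qed

lemma tendsto_line_pt_iff:
  assumes "F \<noteq> bot" "(\<phi> \<longlongrightarrow> L) F"
  shows "((\<lambda>i. line_pt (\<phi> i)) \<longlongrightarrow> z) F \<longleftrightarrow> z = line_pt L"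
proof -
  have "((\<lambda>i. line_pt (\<phi> i)) \<longlongrightarrow> line_pt L) F"
    unfolding line_pt_def cis_conv_exp by (intro tendsto_intros assms)
  then show ?thesis using tendsto_unique[OF assms(1)] by blast
qed

text \<open>Passing to the limit in \<open>j\<close> and then in \<open>i\<close> in
  \<open>\<phi> j \<le> \<phi> i + pi\<close> gives the bound on \<open>U\<close>. Equality can
  occur: both ends of the path then converge to the same point. The parameter \<open>t\<close>
  allows the angles of two paths to be placed side by side.\<close>

lemma clockwise_lift_angles:
  assumes lift: "is_lift a b \<gamma>" and pos: "\<And>i j. i < j \<Longrightarrow> a i * b j - b i * a j > 0"
  obtains r \<phi> L U where "\<And>i. r i > 0" "\<And>i. real_of_int (a i) = r i * cos (\<phi> i)"
    "\<And>i. real_of_int (b i) = r i * sin (\<phi> i)"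
    "\<And>i j. i < j \<Longrightarrow> \<phi> i < \<phi> j \<and> \<phi> j < \<phi> i + pi" "t - pi < \<phi> 0" "\<phi> 0 \<le> t + pi"
    "(\<phi> \<longlongrightarrow> L) at_bot" "(\<phi> \<longlongrightarrow> U) at_top" "\<And>i. L < \<phi> i" "\<And>i. \<phi> i < U" "U \<le> L + pi"
    "\<And>A. backward_limit \<gamma> A \<longleftrightarrow> circ A = line_pt L"
    "\<And>A. forward_limit \<gamma> A \<longleftrightarrow> circ A = line_pt U"
proof -
  obtain r \<phi> where p: "\<And>i. r i > 0" "\<And>i. real_of_int (a i) = r i * cos (\<phi> i)"
    "\<And>i. real_of_int (b i) = r i * sin (\<phi> i)"
    "\<And>i j. i < j \<Longrightarrow> \<phi> i < \<phi> j \<and> \<phi> j < \<phi> i + pi" "t - pi < \<phi> 0" "\<phi> 0 \<le> t + pi"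
    and circ: "\<And>i. circ (real_path \<gamma> i) = line_pt (\<phi> i)"
    by (rule angles_of_lift[OF lift pos, of t]) (assumption, rule that)
  obtain L U where l: "(\<phi> \<longlongrightarrow> L) at_bot" "(\<phi> \<longlongrightarrow> U) at_top" "\<And>i. L < \<phi> i" "\<And>i. \<phi> i < U"
    by (rule strict_mono_int_limits[OF p(4)]) (assumption, rule that)
  have "\<phi> j \<le> \<phi> i + pi" for i j
    using p(4)[of i j] p(4)[of j i] pi_gt_zero by (cases i j rule: linorder_cases) auto
  then have "U \<le> \<phi> i + pi" for i
    by (intro tendsto_upperbound[OF l(2)]) (auto intro: always_eventually)
  then have "U - pi \<le> L"
    by (intro tendsto_lowerbound[OF l(1)]) (auto intro: always_eventually simp: diff_le_eq)
  then have "U \<le> L + pi" by simp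
  moreover have "backward_limit \<gamma> A \<longleftrightarrow> circ A = line_pt L" for A
    unfolding backward_limit_def circ by (rule tendsto_line_pt_iff[OF _ l(1)]) simp
  moreover have "forward_limit \<gamma> A \<longleftrightarrow> circ A = line_pt U" for A
    unfolding forward_limit_def circ by (rule tendsto_line_pt_iff[OF _ l(2)]) simp
  ultimately show thesis using that[OF p l] by blast
qed


section \<open>The order of the limit points\<close>

lemma clockwise_listD:
  assumes "clockwise_list xs" "i < j" "j < k" "k < length xs"
  shows "cw3 (circ (xs ! i)) (circ (xs ! j)) (circ (xs ! k))"
  using assms unfolding clockwise_list_def clockwise_on_def by auto

lemma clockwise_list_distinct: "clockwise_list xs \<Longrightarrow> distinct xs"
  by (auto simp: clockwise_list_def clockwise_on_def inj_on_def distinct_conv_nth)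

lemma clockwise_listI:
  assumes pts: "list_all2 (\<lambda>A \<phi>. circ A = line_pt \<phi>) xs \<phi>s"
    and sorted: "sorted_wrt (\<lambda>\<phi> \<psi>. \<phi> < \<psi> \<and> \<psi> < \<phi> + pi) \<phi>s"
  shows "clockwise_list xs"
proof -
  have len: "length \<phi>s = length xs" using pts by (simp add: list_all2_lengthD)
  have circ: "circ (xs ! i) = line_pt (\<phi>s ! i)" if "i < length xs" for i
    using pts that by (rule list_all2_nthD)
  have mono: "\<phi>s ! i < \<phi>s ! j \<and> \<phi>s ! j < \<phi>s ! i + pi" if "i < j" "j < length xs" for i j
    using sorted_wrt_nth_less[OF sorted that(1)] that(2) len by simp
  have "xs ! i \<noteq> xs ! j" if "i < j" "j < length xs" for i j
    using line_pt_neq mono[OF that] circ[of i] circ[of j] that by (metis order.strict_trans)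
  then have "inj_on (\<lambda>i. xs ! i) {..<length xs}"
    by (intro linorder_inj_onI) auto
  moreover have "cw3 (circ (xs ! i)) (circ (xs ! j)) (circ (xs ! k))"
    if "i < j" "j < k" "k < length xs" for i j k
    using that mono[of i j] mono[of j k] mono[of i k] by (simp add: circ cw3_line_ptI)
  ultimately show ?thesis
    unfolding clockwise_list_def clockwise_on_def by auto
qed

text \<open>The coincidences are read off from the angles: \<open>B = C\<close> means
  \<open>U1 = L2\<close>, and \<open>A = D\<close> means \<open>U2 = L1 + pi\<close>. In each case
  of \<open>limits_clockwise\<close> the points that remain have strictly increasing angles of
  spread below \<open>pi\<close>.\<close>

lemma limits_clockwiseI:
  assumes pts: "circ A = line_pt L1" "circ B = line_pt U1" "circ C = line_pt L2" "circ D = line_pt U2"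
    and ord: "L1 < U1" "U1 \<le> L2" "L2 < U2" "U2 \<le> L1 + pi"
  shows "limits_clockwise A B C D"
proof -
  have BC: "B = C \<longleftrightarrow> U1 = L2"
  proof (cases "U1 = L2")
    case False
    then have "circ B \<noteq> circ C" unfolding pts using line_pt_neq[of U1 L2] ord by linarith
    then show ?thesis using False by blast
  qed (use pts circ_inj in metis)
  have AD: "A = D \<longleftrightarrow> U2 = L1 + pi"
    using line_pt_eq_iff[of L1 U2] ord unfolding circ_inj[symmetric] pts by simp
  have "A \<noteq> B" using line_pt_neq[of L1 U1] ord pts by auto
  moreover have "clockwise_list [A, B, D]" if "A \<noteq> D"
    by (rule clockwise_listI[where \<phi>s = "[L1, U1, U2]"]) (use that AD ord pts in auto)
  moreover have "clockwise_list [A, B, C]" if "B \<noteq> C"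
    by (rule clockwise_listI[where \<phi>s = "[L1, U1, L2]"]) (use that BC ord pts in auto)
  moreover have "clockwise_list [A, B, C, D]" if "A \<noteq> D" "B \<noteq> C"
    by (rule clockwise_listI[where \<phi>s = "[L1, U1, L2, U2]"]) (use that AD BC ord pts in auto)
  ultimately show ?thesis unfolding limits_clockwise_def by auto
qed

lemma pos_factor:
  fixes x y z :: real
  assumes "x \<ge> 0" "y \<ge> 0" "x * y * z > 0"
  shows "z > 0"
  using mult_nonneg_nonpos[of "x * y" z] assms by (cases "z > 0") auto

text \<open>Shifting the second pair of angles by a multiple of \<open>pi\<close> keeps the points,
  so the lower one may be placed at \<open>l\<close> with \<open>L1 \<le> l < L1 + pi\<close>.
  Coincidence of \<open>B\<close> and \<open>C\<close>, or the order of \<open>A\<close>,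
  \<open>B\<close>, \<open>C\<close>, then bounds \<open>U1\<close> by \<open>l\<close>; likewise
  \<open>A\<close>, \<open>C\<close>, \<open>D\<close> bound \<open>u\<close>.\<close>

lemma limits_clockwiseD:
  assumes pts: "circ A = line_pt L1" "circ B = line_pt U1" "circ C = line_pt L2" "circ D = line_pt U2"
    and ord: "L1 < U1" "U1 \<le> L1 + pi" "L2 < U2" "U2 \<le> L2 + pi"
    and lim: "limits_clockwise A B C D"
  shows "\<exists>k. U1 \<le> L2 + of_int k * pi \<and> U2 + of_int k * pi \<le> L1 + pi"
proof -
  \<comment> \<open>The shift removes the whole multiples of \<open>pi\<close> by which
    \<open>L2\<close> exceeds \<open>L1\<close>.\<close>
  define k where "k = - \<lfloor>(L2 - L1) / pi\<rfloor>"
  define l u where "l = L2 + of_int k * pi" and "u = U2 + of_int k * pi"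
  have "of_int (- k) \<le> (L2 - L1) / pi" "(L2 - L1) / pi < of_int (- k) + 1"
    unfolding k_def by (simp_all add: floor_correct)
  then have l: "L1 \<le> l" "l < L1 + pi"
    by (simp_all add: l_def field_simps)
  have u: "l < u" "u \<le> l + pi" using ord by (simp_all add: l_def u_def)
  have pts': "circ C = line_pt l" "circ D = line_pt u"
    using pts by (simp_all add: l_def u_def line_pt_shift)
  have AB: "A \<noteq> B"
    using lim unfolding limits_clockwise_def
    by (auto split: if_splits dest: clockwise_list_distinct)
  then have "U1 \<noteq> L1 + pi"
    using line_pt_eq_iff[OF ord(1,2)] unfolding circ_inj[symmetric] pts by simp
  with ord have U1: "U1 < L1 + pi" by simp
  have "U1 \<le> l"
  proof (cases "B = C")
    case True
    then have "line_pt U1 = line_pt l" using pts pts' by simp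
    then show ?thesis using line_pt_neq[of l U1] U1 l by force
  next
    case False
    then consider "clockwise_list [A, B, C]" | "clockwise_list [A, B, C, D]"
      using lim unfolding limits_clockwise_def by (auto split: if_splits)
    then have "cw3 (circ A) (circ B) (circ C)"
      by cases (use clockwise_listD[of _ 0 1 2] in \<open>force simp: numeral_2_eq_2\<close>)+
    then have "sin (U1 - L1) * sin (l - U1) * sin (l - L1) > 0"
      unfolding pts(1,2) pts'(1) by (rule cw3_line_ptD)
    then have "sin (U1 - L1) * sin (l - L1) * sin (l - U1) > 0"
      by (simp only: mult.assoc mult.commute[of "sin (l - U1)"])
    \<comment> \<open>The second sine is only known to be nonnegative at this point;
      \<open>pos_factor\<close> still isolates the sign of the third.\<close>
    moreover have "sin (U1 - L1) > 0" "sin (l - L1) \<ge> 0"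
      using ord U1 l by (auto intro!: sin_gt_zero sin_ge_zero)
    ultimately have "sin (l - U1) > 0"
      using pos_factor[of "sin (U1 - L1)" "sin (l - L1)"] by (meson less_imp_le)
    then show ?thesis using sin_pos_range[of "l - U1"] l ord U1 by auto
  qed
  moreover have "u \<le> L1 + pi"
  proof (cases "A = D")
    case True
    then have "sin (u - L1) = 0" using pts pts' line_pt_eqD by metis
    then show ?thesis using sin_zero_range[of "u - L1"] l u \<open>U1 \<le> l\<close> ord by auto
  next
    case False
    \<comment> \<open>If \<open>B = C\<close>, then \<open>C\<close> takes the place of
      \<open>B\<close> in the three-point list; otherwise it has index 2 in the four-point
      list.\<close>
    have "cw3 (circ A) (circ C) (circ D)"
    proof (cases "B = C")
      case True
      then have "clockwise_list [A, B, D]" using False lim by (simp add: limits_clockwise_def)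
      then show ?thesis using True clockwise_listD[of "[A, B, D]" 0 1 2] by simp
    next
      case BC: False
      then have "clockwise_list [A, B, C, D]" using False lim by (simp add: limits_clockwise_def)
      then show ?thesis using clockwise_listD[of "[A, B, C, D]" 0 2 3] by simp
    qed
    then have "sin (l - L1) * sin (u - l) * sin (u - L1) > 0"
      unfolding pts(1) pts' by (rule cw3_line_ptD)
    moreover have "sin (l - L1) > 0" "sin (u - l) \<ge> 0"
      using ord u l \<open>U1 \<le> l\<close> by (auto intro!: sin_gt_zero sin_ge_zero)
    ultimately have "sin (u - L1) > 0"
      using pos_factor[of "sin (l - L1)" "sin (u - l)"] by (meson less_imp_le)
    then show ?thesis using sin_pos_range[of "u - L1"] l u by auto
  qed
  ultimately show ?thesis unfolding l_def u_def by blast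
qed


section \<open>Positivity\<close>

lemma PP_plus_imp_paths: "PP_plus \<subseteq> paths \<times> paths"
  by (auto simp: PP_plus_def clockwise_path_def)

text \<open>Shifting the angles of \<open>\<delta>\<close> by \<open>k * pi\<close> puts each of
  them above each \<open>\<phi> i\<close> by less than \<open>pi\<close>, so every shifted sine is
  positive. The shift multiplies all sines by the same sign (-1)^k, which is
  \<open>s\<close>.\<close>

lemma PP_plus_lift_positive:
  assumes p: "(\<gamma>, \<delta>) \<in> PP_plus" and lift: "is_lift a b \<gamma>" "is_lift c d \<delta>"
  obtains s :: int where "s \<in> {1, -1}" "\<And>i j. s * lift_tiling a b c d i j > 0"
proof -
  have cw: "clockwise_path \<gamma>" "clockwise_path \<delta>" using p by (auto simp: PP_plus_def)
  obtain A B C D where lim: "backward_limit \<gamma> A" "forward_limit \<gamma> B"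
    "backward_limit \<delta> C" "forward_limit \<delta> D" "limits_clockwise A B C D"
    using p by (auto simp: PP_plus_def)
  obtain r \<phi> L1 U1 where g: "\<And>i. r i > 0" "\<And>i. real_of_int (a i) = r i * cos (\<phi> i)"
    "\<And>i. real_of_int (b i) = r i * sin (\<phi> i)"
    "\<And>i j. i < j \<Longrightarrow> \<phi> i < \<phi> j \<and> \<phi> j < \<phi> i + pi" "0 - pi < \<phi> 0" "\<phi> 0 \<le> 0 + pi"
    "(\<phi> \<longlongrightarrow> L1) at_bot" "(\<phi> \<longlongrightarrow> U1) at_top" "\<And>i. L1 < \<phi> i" "\<And>i. \<phi> i < U1" "U1 \<le> L1 + pi"
    and limg: "\<And>A. backward_limit \<gamma> A \<longleftrightarrow> circ A = line_pt L1"
    "\<And>A. forward_limit \<gamma> A \<longleftrightarrow> circ A = line_pt U1"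
    by (rule clockwise_lift_angles[OF lift(1) clockwise_path_det_pos[OF lift(1) cw(1)], of 0]) (assumption, rule that)
  obtain q \<psi> L2 U2 where h: "\<And>i. q i > 0" "\<And>i. real_of_int (c i) = q i * cos (\<psi> i)"
    "\<And>i. real_of_int (d i) = q i * sin (\<psi> i)"
    "\<And>i j. i < j \<Longrightarrow> \<psi> i < \<psi> j \<and> \<psi> j < \<psi> i + pi" "0 - pi < \<psi> 0" "\<psi> 0 \<le> 0 + pi"
    "(\<psi> \<longlongrightarrow> L2) at_bot" "(\<psi> \<longlongrightarrow> U2) at_top" "\<And>i. L2 < \<psi> i" "\<And>i. \<psi> i < U2" "U2 \<le> L2 + pi"
    and limh: "\<And>A. backward_limit \<delta> A \<longleftrightarrow> circ A = line_pt L2"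
    "\<And>A. forward_limit \<delta> A \<longleftrightarrow> circ A = line_pt U2"
    by (rule clockwise_lift_angles[OF lift(2) clockwise_path_det_pos[OF lift(2) cw(2)], of 0]) (assumption, rule that)
  have "L1 < U1" "L2 < U2" using g(9,10)[of 0] h(9,10)[of 0] by auto
  then obtain k where k: "U1 \<le> L2 + of_int k * pi" "U2 + of_int k * pi \<le> L1 + pi"
    using limits_clockwiseD[OF _ _ _ _ _ g(11) _ h(11) lim(5)] lim(1-4) limg limh by blast
  define s :: int where "s = (if even k then 1 else -1)"
  have cosk: "cos (of_int k * pi) = of_int s" "sin (of_int k * pi) = 0"
    by (simp_all add: s_def cos_int_times_real sin_int_times_real mult.commute)
  have "s * lift_tiling a b c d i j > 0" for i j
  proof -
    have "0 < sin (\<psi> j + of_int k * pi - \<phi> i)"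
      using g(9,10)[of i] h(9,10)[of j] k by (intro sin_gt_zero) linarith+
    also have "\<dots> = of_int s * sin (\<psi> j - \<phi> i)"
      using cosk sin_add[of "\<psi> j - \<phi> i" "of_int k * pi"] by (simp add: algebra_simps)
    finally have "0 < r i * q j * (of_int s * sin (\<psi> j - \<phi> i))" using g(1) h(1) by simp
    also have "\<dots> = of_int s * of_int (a i * d j - b i * c j)"
      unfolding det_polar[OF g(2,3) h(2,3)] by simp
    also have "\<dots> = of_int (s * lift_tiling a b c d i j)" by (simp add: lift_tiling_def)
    finally show ?thesis by linarith
  qed
  then show thesis using that[of s] by (auto simp: s_def)
qed

text \<open>With the angles of \<open>\<delta>\<close> centred at \<open>\<phi> 0\<close>,
  \<open>sin_pos_range\<close> locates first \<open>\<psi> 0 - \<phi> 0\<close>, then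
  \<open>\<psi> j - \<phi> 0\<close>, then \<open>\<psi> j - \<phi> i\<close>; the spread of one
  path keeps each step inside the window. Passing to the limits orders the four ends.\<close>

lemma PP_plusI:
  assumes lift: "is_lift a b \<gamma>" "is_lift c d \<delta>"
    and pos: "\<And>i j. i < j \<Longrightarrow> a i * b j - b i * a j > 0" "\<And>i j. i < j \<Longrightarrow> c i * d j - d i * c j > 0"
      "\<And>i j. a i * d j - b i * c j > 0"
  shows "(\<gamma>, \<delta>) \<in> PP_plus"
proof -
  obtain r \<phi> L1 U1 where g: "\<And>i. r i > 0" "\<And>i. real_of_int (a i) = r i * cos (\<phi> i)"
    "\<And>i. real_of_int (b i) = r i * sin (\<phi> i)"
    "\<And>i j. i < j \<Longrightarrow> \<phi> i < \<phi> j \<and> \<phi> j < \<phi> i + pi" "0 - pi < \<phi> 0" "\<phi> 0 \<le> 0 + pi"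
    "(\<phi> \<longlongrightarrow> L1) at_bot" "(\<phi> \<longlongrightarrow> U1) at_top" "\<And>i. L1 < \<phi> i" "\<And>i. \<phi> i < U1" "U1 \<le> L1 + pi"
    and limg: "\<And>A. backward_limit \<gamma> A \<longleftrightarrow> circ A = line_pt L1"
    "\<And>A. forward_limit \<gamma> A \<longleftrightarrow> circ A = line_pt U1"
    by (rule clockwise_lift_angles[OF lift(1) pos(1), of 0]) (assumption, rule that)
  obtain q \<psi> L2 U2 where h: "\<And>i. q i > 0" "\<And>i. real_of_int (c i) = q i * cos (\<psi> i)"
    "\<And>i. real_of_int (d i) = q i * sin (\<psi> i)"
    "\<And>i j. i < j \<Longrightarrow> \<psi> i < \<psi> j \<and> \<psi> j < \<psi> i + pi" "\<phi> 0 - pi < \<psi> 0" "\<psi> 0 \<le> \<phi> 0 + pi"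
    "(\<psi> \<longlongrightarrow> L2) at_bot" "(\<psi> \<longlongrightarrow> U2) at_top" "\<And>i. L2 < \<psi> i" "\<And>i. \<psi> i < U2" "U2 \<le> L2 + pi"
    and limh: "\<And>A. backward_limit \<delta> A \<longleftrightarrow> circ A = line_pt L2"
    "\<And>A. forward_limit \<delta> A \<longleftrightarrow> circ A = line_pt U2"
    by (rule clockwise_lift_angles[OF lift(2) pos(2), of "\<phi> 0"]) (assumption, rule that)
  have sin: "sin (\<psi> j - \<phi> i) > 0" for i j
    using pos(3)[of i j] det_polar_pos[OF g(1) h(1) g(2,3) h(2,3)] by metis
  have spread: "\<phi> i < \<phi> j + pi" "\<psi> i < \<psi> j + pi" for i j
    using g(4)[of i j] g(4)[of j i] h(4)[of i j] h(4)[of j i] pi_gt_zero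
    by (cases i j rule: linorder_cases; fastforce)+
  have 0: "0 < \<psi> 0 - \<phi> 0 \<and> \<psi> 0 - \<phi> 0 < pi"
    by (rule sin_pos_range[OF sin]) (use h(5,6) pi_gt_zero in linarith)+
  have 1: "0 < \<psi> j - \<phi> 0 \<and> \<psi> j - \<phi> 0 < pi" for j
    by (rule sin_pos_range[OF sin]) (use 0 spread(2)[of j 0] spread(2)[of 0 j] in linarith)+
  have 2: "0 < \<psi> j - \<phi> i \<and> \<psi> j - \<phi> i < pi" for i j
    by (rule sin_pos_range[OF sin]) (use 1[of j] spread(1)[of i 0] spread(1)[of 0 i] in linarith)+
  have "U1 \<le> \<psi> j" for j
    by (rule tendsto_upperbound[OF g(8)]) (use 2[of j] in \<open>auto intro!: always_eventually simp: less_imp_le\<close>)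
  then have "U1 \<le> L2"
    by (intro tendsto_lowerbound[OF h(7)]) (auto intro!: always_eventually)
  moreover have "U2 \<le> \<phi> i + pi" for i
    by (rule tendsto_upperbound[OF h(8)]) (use 2[of _ i] in \<open>auto intro!: always_eventually simp: less_imp_le algebra_simps\<close>)
  then have "U2 - pi \<le> L1"
    by (intro tendsto_lowerbound[OF g(7)]) (auto intro!: always_eventually simp: diff_le_eq)
  then have "U2 \<le> L1 + pi" by simp
  moreover have "L1 < U1" "L2 < U2"
    using g(9,10)[of 0] h(9,10)[of 0] by auto
  ultimately have lim: "limits_clockwise A B C D"
    if "circ A = line_pt L1" "circ B = line_pt U1" "circ C = line_pt L2" "circ D = line_pt U2"
    for A B C D using limits_clockwiseI[OF that] by blast
  \<comment> \<open>\<open>circ_cot\<close> supplies a point for every angle, so the limit points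
    exist.\<close>
  have "\<exists>A. circ A = line_pt t" for t using circ_cot by metis
  then obtain A B C D where pts: "circ A = line_pt L1" "circ B = line_pt U1" "circ C = line_pt L2"
    "circ D = line_pt U2" by metis
  have "clockwise_path \<gamma>" by (rule clockwise_pathI[OF lift(1) pos(1)])
  moreover have "clockwise_path \<delta>" by (rule clockwise_pathI[OF lift(2) pos(2)])
  moreover have "backward_limit \<gamma> A" "forward_limit \<gamma> B" "backward_limit \<delta> C" "forward_limit \<delta> D"
    using pts by (simp_all add: limg limh)
  ultimately show ?thesis
    using lim[OF pts] by (auto simp: PP_plus_def)
qed


section \<open>From tilings back to paths\<close>

lemma int_both_ways_induct:
  fixes P :: "int \<Rightarrow> bool"
  assumes "P 0" "\<And>i. P i \<Longrightarrow> P (i + 1)" "\<And>i. P (i + 1) \<Longrightarrow> P i"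
  shows "P i"
  by (induction i rule: int_induct[where k = 0]) (use assms(1,2) assms(3)[of "_ - 1"] in auto)

text \<open>In a 2 by 2 block three entries fix the fourth once the entry diagonally opposite is
  nonzero. Spreading from row 0 and column 0 puts each of the four corners in the unknown role, one
  for each pair of directions of the nested inductions.\<close>

lemma sl2_tiling_determined:
  assumes M: "sl2_tiling M" and N: "sl2_tiling N" and nz: "\<And>i j. M i j \<noteq> 0"
    and row: "\<And>j. N 0 j = M 0 j" and col: "\<And>i. N i 0 = M i 0"
  shows "N = M"
proof -
  have m: "M i j * M (i+1) (j+1) - M i (j+1) * M (i+1) j = 1"
    and n: "N i j * N (i+1) (j+1) - N i (j+1) * N (i+1) j = 1" for i j
    using M N by (simp_all add: sl2_tiling_def)
  have "\<forall>j. N i j = M i j" for i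
  proof (induction i rule: int_both_ways_induct)
    case 1
    show ?case using row by simp
  next
    case (2 i)
    have "N (i+1) j = M (i+1) j" for j
    proof (induction j rule: int_both_ways_induct)
      case 1
      show ?case by (rule col)
    next
      case (2 j)
      have "M i j * (N (i+1) (j+1) - M (i+1) (j+1)) = 0"
        using m[of i j] n[of i j] 2 \<open>\<forall>j. N i j = M i j\<close> by (auto simp: algebra_simps)
      then show ?case using nz by auto
    next
      case (3 j)
      have "M i (j+1) * (N (i+1) j - M (i+1) j) = 0"
        using m[of i j] n[of i j] 3 \<open>\<forall>j. N i j = M i j\<close> by (auto simp: algebra_simps)
      then show ?case using nz by auto
    qed
    then show ?case by simp
  next
    case (3 i)
    have "N i j = M i j" for j
    proof (induction j rule: int_both_ways_induct)
      case 1
      show ?case by (rule col)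
    next
      case (2 j)
      have "M (i+1) j * (N i (j+1) - M i (j+1)) = 0"
        using m[of i j] n[of i j] 2 \<open>\<forall>j. N (i+1) j = M (i+1) j\<close> by (auto simp: algebra_simps)
      then show ?case using nz by auto
    next
      case (3 j)
      have "M (i+1) (j+1) * (N i j - M i j) = 0"
        using m[of i j] n[of i j] 3 \<open>\<forall>j. N (i+1) j = M (i+1) j\<close> by (auto simp: algebra_simps)
      then show ?case using nz by auto
    qed
    then show ?case by simp
  qed
  then show ?thesis by (simp add: fun_eq_iff)
qed

lemma is_lift_exists_path:
  assumes det: "\<And>i. a i * b (i+1) - a (i+1) * b i = 1"
  obtains \<gamma> where "is_lift a b \<gamma>"
proof -
  have "coprime (a i) (b i)" for i
  proof (rule coprimeI)
    fix k assume "k dvd a i" "k dvd b i"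
    then have "k dvd a i * b (i+1) - a (i+1) * b i" by simp
    then show "is_unit k" using det by simp
  qed
  then have "is_lift a b (\<lambda>i. if b i = 0 then Infty else Fin (of_int (a i) / of_int (b i)))"
    using det by (simp add: is_lift_def reduced_rational_def)
  then show thesis by (rule that)
qed

text \<open>By \<open>half\<close> all vectors lie strictly on one side of the line through
  \<open>(x, y)\<close>, where positivity of determinants is transitive.\<close>

lemma det_pos_of_half_plane:
  fixes a b :: "int \<Rightarrow> int"
  assumes det: "\<And>i. a i * b (i+1) - a (i+1) * b i = 1"
    and half: "\<And>i. x * b i - y * a i > 0"
    and ij: "i < j"
  shows "a i * b j - b i * a j > 0"
  using ij
proof (induction j rule: int_gr_induct)
  case base
  show ?case using det[of i] by (simp add: algebra_simps)
next
  case (step j)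
  \<comment> \<open>Three-term Pluecker relation between \<open>(x, y)\<close> and the vectors with
    indices \<open>i\<close>, \<open>j\<close>, \<open>j + 1\<close>.\<close>
  have "(x * b j - y * a j) * (a i * b (j+1) - b i * a (j+1)) =
      (x * b i - y * a i) * (a j * b (j+1) - a (j+1) * b j)
      + (x * b (j+1) - y * a (j+1)) * (a i * b j - b i * a j)"
    by (simp add: algebra_simps)
  also have "\<dots> > 0"
    unfolding det using half step by (intro add_pos_pos mult_pos_pos) auto
  finally show ?case using half[of j] by (simp add: zero_less_mult_iff)
qed

lemma positive_tiling_lift:
  assumes M: "sl2_tiling M" and pos: "\<And>i j. M i j > 0"
  obtains \<gamma> \<delta> a b c d where "(\<gamma>, \<delta>) \<in> PP_plus" "is_lift a b \<gamma>" "is_lift c d \<delta>" "lift_tiling a b c d = M"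
proof -
  have m: "M i j * M (i+1) (j+1) - M i (j+1) * M (i+1) j = 1" for i j
    using M by (simp add: sl2_tiling_def)
  \<comment> \<open>With w_0 = (1, 0) and w_1 = (0, 1), columns 0 and 1 of the tiling prescribe the
    coordinates of v_i.\<close>
  define a b where "a i = M i 1" and "b i = - M i 0" for i
  \<comment> \<open>Solves det (v_0, w_j) = \<open>M 0 j\<close> and det (v_1, w_j) =
    \<open>M 1 j\<close> in the basis v_0, v_1, which has determinant 1.\<close>
  define c d where "c j = - M 1 j * a 0 + M 0 j * a 1" and "d j = - M 1 j * b 0 + M 0 j * b 1" for j
  have ab: "a i * b (i+1) - a (i+1) * b i = 1" for i
    using m[of i 0] by (simp add: a_def b_def algebra_simps)
  have cd: "c j * d (j+1) - c (j+1) * d j = 1" for j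
    using m[of 0 j] ab[of 0] unfolding c_def d_def by simp algebra
  obtain \<gamma> where \<gamma>: "is_lift a b \<gamma>" using is_lift_exists_path[of a b, OF ab] .
  obtain \<delta> where \<delta>: "is_lift c d \<delta>" using is_lift_exists_path[of c d, OF cd] .
  have "c 0 = 1" "d 0 = 0"
    using m[of 0 0] by (simp_all add: a_def b_def c_def d_def algebra_simps)
  then have "lift_tiling a b c d i 0 = M i 0" for i
    by (simp add: lift_tiling_def b_def)
  moreover have "lift_tiling a b c d 0 j = M 0 j" for j
    using ab[of 0] unfolding lift_tiling_def c_def d_def by simp algebra
  ultimately have eq: "lift_tiling a b c d = M"
    using pos by (intro sl2_tiling_determined[OF M lift_tiling_tame(1)[OF \<gamma> \<delta>]]) (auto simp: less_le)
  have mixed: "a i * d j - b i * c j > 0" for i j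
    using pos[of i j] unfolding eq[symmetric] lift_tiling_def .
  have "a i * b j - b i * a j > 0" if "i < j" for i j
  proof (rule det_pos_of_half_plane[of a b, OF ab _ that])
    \<comment> \<open>Column 0 puts all v_i on one side of the line through w_0, with
      \<open>(x, y)\<close> = - w_0; below, row 0 does the same for all w_j and v_0.\<close>
    show "- c 0 * b i - (- d 0) * a i > 0" for i
      using mixed[of i 0] by (simp add: algebra_simps)
  qed
  moreover have "c i * d j - d i * c j > 0" if "i < j" for i j
    by (rule det_pos_of_half_plane[of c d, OF cd mixed[of 0] that])
  ultimately have "(\<gamma>, \<delta>) \<in> PP_plus"
    using mixed by (intro PP_plusI[OF \<gamma> \<delta>])
  then show thesis using that \<gamma> \<delta> eq by blast
qed


section \<open>Uniqueness up to the action\<close>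

lemma reduced_rational_functional:
  "reduced_rational a b u \<Longrightarrow> reduced_rational a b v \<Longrightarrow> u = v"
  by (simp add: reduced_rational_def)

lemma equal_tilings_imp_orbit_rel:
  assumes lift: "is_lift a b \<gamma>" "is_lift c d \<delta>" "is_lift a' b' \<gamma>'" "is_lift c' d' \<delta>'"
    and eq: "lift_tiling a b c d = lift_tiling a' b' c' d'"
  shows "((\<gamma>, \<delta>), (\<gamma>', \<delta>')) \<in> orbit_rel"
proof -
  have e: "a i * d j - b i * c j = a' i * d' j - b' i * c' j" for i j
    using eq unfolding lift_tiling_def by meson
  have v: "a 0 * b 1 - a 1 * b 0 = 1" "a' 0 * b' 1 - a' 1 * b' 0 = 1"
    and w: "c' 0 * d' 1 - c' 1 * d' 0 = 1"
    using lift unfolding is_lift_def by (metis add_0)+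
  \<comment> \<open>Entries of the matrix with columns v'_0, v'_1 times the inverse of the one with
    columns v_0, v_1.\<close>
  define p q r s where "p = a' 0 * b 1 - a' 1 * b 0" and "q = a' 1 * a 0 - a' 0 * a 1"
    and "r = b' 0 * b 1 - b' 1 * b 0" and "s = b' 1 * a 0 - b' 0 * a 1"
  have det: "p * s - q * r = 1"
    using v unfolding p_def q_def r_def s_def by algebra
  \<comment> \<open>A vector is determined by its determinants with two independent vectors: rows 0
    and 1 fix every w'_j, and then columns 0 and 1 fix every v'_i.\<close>
  have c: "c' j = p * c j + q * d j" and d: "d' j = r * c j + s * d j" for j
    using e[of 0 j] e[of 1 j] v unfolding p_def q_def r_def s_def by algebra+
  have a: "a' i = p * a i + q * b i" and b: "b' i = r * a i + s * b i" for i
    using e[of i 0] e[of i 1] w det unfolding c d by algebra+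
  define A :: "int^2^2" where "A = vector [vector [p, q], vector [r, s]]"
  have A: "A$1$1 = p" "A$1$2 = q" "A$2$1 = r" "A$2$2 = s"
    by (simp_all add: A_def)
  have SL: "A \<in> SL2Z" using det by (simp add: SL2Z_def det_2 A)
  have "moebius A (\<gamma> i) = \<gamma>' i" "moebius A (\<delta> i) = \<delta>' i" for i
    using lift reduced_moebius[OF SL, of "a i" "b i" "\<gamma> i"] reduced_moebius[OF SL, of "c i" "d i" "\<delta> i"]
    unfolding A a[symmetric] b[symmetric] c[symmetric] d[symmetric] is_lift_def
    by (blast intro: reduced_rational_functional)+
  then have "(\<gamma>', \<delta>') = act A (\<gamma>, \<delta>)" by (simp add: act_def fun_eq_iff)
  then show ?thesis using SL unfolding orbit_rel_def by blast
qed

text \<open>The sign between the two tilings is absorbed by negating the lift of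
  \<open>\<delta>'\<close>, which represents the same vertices.\<close>

lemma Phi_tilde_eq_imp_orbit_rel:
  assumes "p \<in> paths \<times> paths" "q \<in> paths \<times> paths" "Phi_tilde p = Phi_tilde q"
  shows "(p, q) \<in> orbit_rel"
proof -
  obtain \<gamma> \<delta> \<gamma>' \<delta>' where pq: "p = (\<gamma>, \<delta>)" "q = (\<gamma>', \<delta>')" by (metis surj_pair)
  obtain a b c d a' b' c' d' where l: "is_lift a b \<gamma>" "is_lift c d \<delta>" "is_lift a' b' \<gamma>'" "is_lift c' d' \<delta>'"
    using assms(1,2) lift_exists unfolding pq mem_Times_iff by (metis fst_conv snd_conv)
  have neg: "is_lift (\<lambda>i. - c' i) (\<lambda>i. - d' i) \<delta>'"
    using l(4) reduced_uminus by (auto simp: is_lift_def)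
  have "(lift_tiling a b c d, lift_tiling a' b' c' d') \<in> sign_rel"
    using assms(3) unfolding pq Phi_tilde_eq[OF l(1,2)] Phi_tilde_eq[OF l(3,4)]
    by (simp add: eq_equiv_class[OF _ equiv_sign_rel])
  then have "lift_tiling a' b' c' d' = lift_tiling a b c d
      \<or> lift_tiling a' b' c' d' = (\<lambda>i j. - lift_tiling a b c d i j)"
    by (simp add: sign_rel_def)
  moreover have "lift_tiling a' b' (\<lambda>i. - c' i) (\<lambda>i. - d' i) = (\<lambda>i j. - lift_tiling a' b' c' d' i j)"
    by (simp add: lift_tiling_def)
  ultimately consider "lift_tiling a b c d = lift_tiling a' b' c' d'"
    | "lift_tiling a b c d = lift_tiling a' b' (\<lambda>i. - c' i) (\<lambda>i. - d' i)"
    by fastforce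
  then show ?thesis
    unfolding pq by cases (use equal_tilings_imp_orbit_rel l neg in blast)+
qed

text \<open>On pairs of paths, being in one orbit amounts to having the same
  \<open>Phi_tilde\<close>, which is visibly symmetric and transitive; this replaces computing with
  inverses and products of matrices.\<close>

lemma orbit_rel_class_eq:
  assumes p: "p \<in> paths \<times> paths" and pq: "(p, q) \<in> orbit_rel"
  shows "orbit_rel `` {p} = orbit_rel `` {q}"
proof -
  have closed: "q' \<in> paths \<times> paths \<and> Phi_tilde q' = Phi_tilde p'"
    if p': "p' \<in> paths \<times> paths" and rel: "(p', q') \<in> orbit_rel" for p' q'
  proof -
    obtain A where A: "A \<in> SL2Z" and q': "q' = act A p'" using rel by (auto simp: orbit_rel_def)
    have "moebius A \<circ> \<gamma> \<in> paths" if "\<gamma> \<in> paths" for \<gamma>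
      using lift_exists[OF that] is_lift_moebius[OF A] is_lift_path by blast
    then show ?thesis using p' Phi_tilde_act[OF A p'] unfolding q' by (auto simp: act_def)
  qed
  note q = closed[OF p pq]
  show ?thesis
  proof (intro equalityI subsetI)
    fix x assume "x \<in> orbit_rel `` {p}"
    then have "x \<in> paths \<times> paths" "Phi_tilde x = Phi_tilde p" using closed[OF p] by auto
    then show "x \<in> orbit_rel `` {q}" using q Phi_tilde_eq_imp_orbit_rel[of q x] by simp
  next
    fix x assume "x \<in> orbit_rel `` {q}"
    then have "x \<in> paths \<times> paths" "Phi_tilde x = Phi_tilde q" using closed[of q x] q by auto
    then show "x \<in> orbit_rel `` {p}" using q Phi_tilde_eq_imp_orbit_rel[OF p] by simp
  qed
qed

section \<open>The bijection between orbits and positive tilings\<close>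

theorem theorem1p2:
  shows "bij_betw Phi (PP_plus // orbit_rel) SL2_plus"
proof (rule bij_betw_imageI)
  show "inj_on Phi (PP_plus // orbit_rel)"
  proof (rule inj_onI)
    fix X Y assume "X \<in> PP_plus // orbit_rel" "Y \<in> PP_plus // orbit_rel" and eq: "Phi X = Phi Y"
    then obtain p q where "p \<in> PP_plus" "q \<in> PP_plus"
      and X: "X = orbit_rel `` {p}" and Y: "Y = orbit_rel `` {q}"
      by (meson quotientE)
    then have p: "p \<in> paths \<times> paths" and q: "q \<in> paths \<times> paths"
      using PP_plus_imp_paths by blast+
    have "(p, q) \<in> orbit_rel"
      using eq Phi_tilde_eq_imp_orbit_rel[OF p q] unfolding X Y Phi_orbit[OF p] Phi_orbit[OF q] by simp
    then show "X = Y" unfolding X Y by (rule orbit_rel_class_eq[OF p])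
  qed
  have "Phi (orbit_rel `` {(\<gamma>, \<delta>)}) \<in> SL2_plus" if pq: "(\<gamma>, \<delta>) \<in> PP_plus" for \<gamma> \<delta>
  proof -
    have path: "(\<gamma>, \<delta>) \<in> paths \<times> paths" using pq PP_plus_imp_paths by blast
    then obtain a b c d where l: "is_lift a b \<gamma>" "is_lift c d \<delta>" using lift_exists by blast
    obtain s :: int where s: "s \<in> {1, -1}" "\<And>i j. s * lift_tiling a b c d i j > 0"
      using PP_plus_lift_positive[OF pq l] by blast
    \<comment> \<open>The positive representative of the class of the lifted tiling.\<close>
    define M where "M = (\<lambda>i j. s * lift_tiling a b c d i j)"
    have "sl2_tiling M"
      using lift_tiling_tame(1)[OF l] s(1) by (auto simp: M_def sl2_tiling_def)
    moreover have "(lift_tiling a b c d, M) \<in> sign_rel"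
      using s(1) by (auto simp: M_def sign_rel_def)
    then have "sign_rel `` {lift_tiling a b c d} = sign_rel `` {M}"
      by (rule equiv_class_eq[OF equiv_sign_rel])
    ultimately show ?thesis
      using s(2) unfolding Phi_orbit[OF path] Phi_tilde_eq[OF l] SL2_plus_def
      by (auto simp: M_def intro!: quotientI)
  qed
  moreover have "sign_rel `` {M} \<in> Phi ` (PP_plus // orbit_rel)"
    if M: "sl2_tiling M" "\<forall>i j. M i j > 0" for M
  proof -
    obtain \<gamma> \<delta> a b c d where pq: "(\<gamma>, \<delta>) \<in> PP_plus" and l: "is_lift a b \<gamma>" "is_lift c d \<delta>"
      and eq: "lift_tiling a b c d = M"
      using positive_tiling_lift[OF M(1)] M(2) by metis
    then have "(\<gamma>, \<delta>) \<in> paths \<times> paths" using PP_plus_imp_paths by blast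
    then have "Phi (orbit_rel `` {(\<gamma>, \<delta>)}) = sign_rel `` {M}"
      using Phi_orbit Phi_tilde_eq[OF l] eq by simp
    then show ?thesis using quotientI[OF pq] by (metis image_eqI)
  qed
  ultimately show "Phi ` (PP_plus // orbit_rel) = SL2_plus"
    by (auto simp: SL2_plus_def elim!: quotientE)
qed

end
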